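(* Assume Erdős' girth conjecture: for every integer $k\ge1$ there exist (infinitely many) graphs with $n$ vertices, $\Omega(n^{1+1/k})$ edges and girth $2k+1$. Then for every integer $k\ge2$ there exist graphs $G$ (an infinite family, with uniform implied constant) with unit edge lengths such that for every $(k-1,1)$-contraction $C$ of $G$, the contracted graph $G/C$ has $\Omega(n^{1+1/k})$ edges, where $n$ is the number of vertices of $G$.
   Context: For $C\subseteq E$, $\ell_C$ equals $0$ on $C$ and $1$ elsewhere. An $(\alpha,\beta)$-contraction is a set $C\subseteq E$ with $\mathrm{dist}_{\ell_C}(u,v)\ge\mathrm{dist}_\ell(u,v)/\alpha-\beta$ for all vertices $u,v$. $G/C$ is the simple graph obtained from $G$ by contracting the edges of $C$, deleting loops and merging parallel edges. The girth is the minimum length of a cycle. *)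

theory Defs
  imports Complex_Main "HOL-Library.Extended_Real"
begin

record 'a ugraph =
  vertex_set :: "'a set"
  edge_set :: "'a set set"

definition simple_graph :: "'a ugraph \<Rightarrow> bool" where
  "simple_graph G \<longleftrightarrow> finite (vertex_set G) \<and>
     (\<forall>e\<in>edge_set G. e \<subseteq> vertex_set G \<and> card e = 2)"

(* Walks are nonempty vertex lists; [u] is the trivial walk from u to u. *)
definition is_walk :: "'a ugraph \<Rightarrow> 'a list \<Rightarrow> bool" where
  "is_walk G p \<longleftrightarrow> p \<noteq> [] \<and> set p \<subseteq> vertex_set G \<and>
     successively (\<lambda>x y. {x, y} \<in> edge_set G) p"

definition walks_between :: "'a ugraph \<Rightarrow> 'a \<Rightarrow> 'a \<Rightarrow> 'a list set" where
  "walks_between G u v = {p. is_walk G p \<and> hd p = u \<and> last p = v}"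

definition walk_length :: "('a set \<Rightarrow> real) \<Rightarrow> 'a list \<Rightarrow> real" where
  "walk_length l p = (\<Sum>(x, y)\<leftarrow>zip p (tl p). l {x, y})"

(* The infimum over the empty set is \<infinity>, so vertices in different components
   are at infinite distance. *)
definition graph_dist :: "'a ugraph \<Rightarrow> ('a set \<Rightarrow> real) \<Rightarrow> 'a \<Rightarrow> 'a \<Rightarrow> ereal" where
  "graph_dist G l u v = (INF p \<in> walks_between G u v. ereal (walk_length l p))"

(* The closing edge from last p to hd p is not repeated in the list, so the
   length of the cycle is length p. *)
definition is_cycle :: "'a ugraph \<Rightarrow> 'a list \<Rightarrow> bool" where
  "is_cycle G p \<longleftrightarrow> is_walk G p \<and> 3 \<le> length p \<and> distinct p \<and>
     {last p, hd p} \<in> edge_set G"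

(* The girth of a forest is \<infinity>. *)
definition graph_girth :: "'a ugraph \<Rightarrow> enat" where
  "graph_girth G = (INF p \<in> {p. is_cycle G p}. enat (length p))"

definition contracted_length :: "'a set set \<Rightarrow> 'a set \<Rightarrow> real" where
  "contracted_length C e = (if e \<in> C then 0 else 1)"

definition is_contraction ::
  "real \<Rightarrow> real \<Rightarrow> 'a ugraph \<Rightarrow> ('a set \<Rightarrow> real) \<Rightarrow> 'a set set \<Rightarrow> bool" where
  "is_contraction \<alpha> \<beta> G l C \<longleftrightarrow> C \<subseteq> edge_set G \<and>
     (\<forall>u\<in>vertex_set G. \<forall>v\<in>vertex_set G.
        graph_dist G (contracted_length C) u v \<ge> graph_dist G l u v / ereal \<alpha> - ereal \<beta>)"

definition component_of :: "'a ugraph \<Rightarrow> 'a \<Rightarrow> 'a set" where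
  "component_of G u = {v. walks_between G u v \<noteq> {}}"

(* The vertices of G/C are the connected components of the spanning subgraph with
   edge set C. Edges inside a component become loops and are dropped; parallel
   edges are merged because the edges form a set. *)
definition contract_edges :: "'a ugraph \<Rightarrow> 'a set set \<Rightarrow> 'a set ugraph" where
  "contract_edges G C =
     (let comp = component_of \<lparr>vertex_set = vertex_set G, edge_set = C\<rparr> in
      \<lparr>vertex_set = comp ` vertex_set G,
       edge_set = {{comp u, comp v} | u v. {u, v} \<in> edge_set G \<and> comp u \<noteq> comp v}\<rparr>)"

(* The constant c may depend on k only. An infinite family of finite simple graphs,
   up to isomorphism, is one with unboundedly many vertices, and every finite graph
   has an isomorphic copy on natural numbers. *)
definition erdos_girth_conjecture :: bool where
  "erdos_girth_conjecture \<longleftrightarrow>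
     (\<forall>k::nat. k \<ge> 1 \<longrightarrow>
       (\<exists>c::real. c > 0 \<and>
         (\<forall>N::nat. \<exists>G::nat ugraph. simple_graph G \<and> card (vertex_set G) \<ge> N \<and>
            real (card (edge_set G)) \<ge> c * real (card (vertex_set G)) powr (1 + 1 / real k) \<and>
            graph_girth G = enat (2 * k + 1))))"

end

theory Submission
  imports Defs
begin

text \<open>
  Let \<open>G\<close> have girth \<open>2k + 1\<close> and let \<open>C\<close> be a \<open>(k - 1, 1)\<close>-contraction. Two vertices joined by a
  \<open>C\<close>-walk are at contracted distance \<open>0\<close>, hence at distance at most \<open>k - 1\<close> in \<open>G\<close>. Two different
  paths with the same ends have at least \<open>2k + 1\<close> edges in total, so, extending a \<open>C\<close>-path edge by
  edge, it stays equal to a geodesic of \<open>G\<close> and has at most \<open>k - 1\<close> edges. The same uniqueness of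
  short paths shows that \<open>C\<close> is a forest, that every edge of \<open>G\<close> inside a component of \<open>C\<close> lies in
  \<open>C\<close>, and that two components are joined by at most one edge. Contracting therefore loses only
  the at most \<open>n\<close> edges of \<open>C\<close>, which is negligible against \<open>n\<close> to the power \<open>1 + 1/k\<close>.
\<close>

section \<open>Walks and paths\<close>

lemma not_is_walk_Nil [simp]: "\<not> is_walk G []"
  by (simp add: is_walk_def)

lemma is_walk_Cons:
  "is_walk G (x # p) \<longleftrightarrow> x \<in> vertex_set G \<and> (p = [] \<or> {x, hd p} \<in> edge_set G \<and> is_walk G p)"
  by (auto simp: is_walk_def successively_Cons)

lemma is_walk_append:
  assumes "p \<noteq> []" "q \<noteq> []"
  shows "is_walk G (p @ q) \<longleftrightarrow> is_walk G p \<and> is_walk G q \<and> {last p, hd q} \<in> edge_set G"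
  using assms by (auto simp: is_walk_def successively_append_iff)

lemma is_walk_rev [simp]: "is_walk G (rev p) \<longleftrightarrow> is_walk G p"
  by (auto simp: is_walk_def insert_commute)

lemma is_walk_mono:
  assumes "is_walk G p" "vertex_set G \<subseteq> vertex_set H" "edge_set G \<subseteq> edge_set H"
  shows "is_walk H p"
  using assms by (auto simp: is_walk_def intro: successively_mono)

lemma walks_between_refl: "u \<in> vertex_set G \<Longrightarrow> [u] \<in> walks_between G u u"
  by (simp add: walks_between_def is_walk_def)

lemma walks_between_rev: "p \<in> walks_between G u v \<Longrightarrow> rev p \<in> walks_between G v u"
  by (auto simp: walks_between_def hd_rev last_rev)

lemma walks_between_append:
  assumes p: "p \<in> walks_between G u v" and q: "q \<in> walks_between G v w"
  shows "p @ tl q \<in> walks_between G u w"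
proof (cases "tl q")
  case Nil
  then have "q = [v]" "w = v" using q by (cases q; auto simp: walks_between_def is_walk_def)+
  then show ?thesis using p by simp
next
  case (Cons y ys)
  then have "q = v # y # ys" using q by (cases q; auto simp: walks_between_def)
  moreover have "p \<noteq> []" using p by (auto simp: walks_between_def)
  ultimately show ?thesis using p q
    by (auto simp: walks_between_def is_walk_append is_walk_Cons)
qed

lemma component_of_eq_iff:
  assumes "u \<in> vertex_set G" "v \<in> vertex_set G"
  shows "component_of G u = component_of G v \<longleftrightarrow> walks_between G u v \<noteq> {}"
proof
  assume "component_of G u = component_of G v"
  then have "v \<in> component_of G u"
    using walks_between_refl[OF assms(2)] by (auto simp: component_of_def)
  then show "walks_between G u v \<noteq> {}" by (simp add: component_of_def)
next
  assume "walks_between G u v \<noteq> {}"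
  then obtain p where p: "p \<in> walks_between G u v" by blast
  show "component_of G u = component_of G v"
    using walks_between_append[OF p] walks_between_append[OF walks_between_rev[OF p]]
    by (fastforce simp: component_of_def)
qed

section \<open>Paths and cycles\<close>

definition paths_between :: "'a ugraph \<Rightarrow> 'a \<Rightarrow> 'a \<Rightarrow> 'a list set" where
  "paths_between G u v = {p \<in> walks_between G u v. distinct p}"

lemma paths_between_iff:
  "p \<in> paths_between G u v \<longleftrightarrow> is_walk G p \<and> hd p = u \<and> last p = v \<and> distinct p"
  by (auto simp: paths_between_def walks_between_def)

lemma Nil_notin_paths_between [simp]: "[] \<notin> paths_between G u v"
  by (simp add: paths_between_iff is_walk_def)

lemma paths_between_mono:
  assumes "p \<in> paths_between G u v" "vertex_set G \<subseteq> vertex_set H" "edge_set G \<subseteq> edge_set H"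
  shows "p \<in> paths_between H u v"
  using assms is_walk_mono by (auto simp: paths_between_iff)

lemma paths_between_suffix:
  assumes "p @ x # q \<in> paths_between G u v"
  shows "x # q \<in> paths_between G x v"
  using assms by (cases "p = []") (auto simp: paths_between_iff is_walk_append)

lemma paths_between_prefix:
  assumes "p @ x # q \<in> paths_between G u v"
  shows "p @ [x] \<in> paths_between G u x"
proof (cases "q = []")
  case False
  then show ?thesis using assms is_walk_append[of "p @ [x]" q G]
    by (cases p) (auto simp: paths_between_iff)
qed (use assms in \<open>auto simp: paths_between_iff\<close>)

lemma paths_between_vertex:
  assumes "p \<in> paths_between G u v" "x \<in> set p"
  shows "walks_between G u x \<noteq> {}"
proof -
  obtain a b where "p = a @ x # b" using assms(2) by (meson split_list)
  then show ?thesis using paths_between_prefix assms(1) by (fastforce simp: paths_between_def)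
qed

lemma paths_between_Cons:
  assumes "p \<in> paths_between G u v" "x \<in> vertex_set G" "{x, u} \<in> edge_set G" "x \<notin> set p"
  shows "x # p \<in> paths_between G x v"
  using assms by (cases p) (auto simp: paths_between_iff is_walk_Cons)

text \<open>Induction on the walk: if its first vertex already lies on the path found for the rest,
  that path is cut back to start there; otherwise the vertex is prepended.\<close>

lemma walk_contains_path:
  assumes "p \<in> walks_between G u v"
  shows "\<exists>q. q \<in> paths_between G u v \<and> length q \<le> length p"
  using assms
proof (induction p arbitrary: u)
  case Nil
  then show ?case by (simp add: walks_between_def is_walk_def)
next
  case (Cons x p)
  then have x: "x = u" "x \<in> vertex_set G" by (auto simp: walks_between_def is_walk_Cons)
  show ?case
  proof (cases "p = []")
    case True
    then show ?thesis using Cons.prems by (intro exI[of _ "[x]"])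
        (auto simp: walks_between_def paths_between_iff)
  next
    case False
    then have "p \<in> walks_between G (hd p) v" and e: "{x, hd p} \<in> edge_set G"
      using Cons.prems by (auto simp: walks_between_def is_walk_Cons)
    then obtain q where q: "q \<in> paths_between G (hd p) v" "length q \<le> length p"
      using Cons.IH by blast
    show ?thesis
    proof (cases "x \<in> set q")
      case True
      then obtain a b where "q = a @ x # b" by (meson split_list)
      then show ?thesis using q paths_between_suffix x by (intro exI[of _ "x # b"]) auto
    next
      case False
      then show ?thesis using q paths_between_Cons x e by (intro exI[of _ "x # q"]) auto
    qed
  qed
qed

lemma ex_path: "walks_between G u v \<noteq> {} \<Longrightarrow> \<exists>p. p \<in> paths_between G u v"
  by (metis ex_in_conv walk_contains_path)

text \<open>A common start is stripped by induction. Once the paths diverge after \<open>u\<close>,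
  the first is followed up to its first vertex \<open>y\<close> on the other, which then leads back
  to \<open>u\<close>. The summand \<open>2\<close> appears because a path has one edge fewer than
  vertices, while a cycle has equally many.\<close>

lemma two_paths_contain_cycle:
  assumes "p \<in> paths_between G u v" "q \<in> paths_between G u v" "p \<noteq> q"
  shows "\<exists>c. is_cycle G c \<and> length c + 2 \<le> length p + length q"
  using assms
proof (induction p arbitrary: u q)
  case Nil
  then show ?case by simp
next
  case (Cons x p)
  then have x: "x = u" by (simp add: paths_between_iff)
  from Cons.prems obtain q' where q: "q = u # q'"
    by (cases q) (auto simp: paths_between_iff is_walk_def)
  have ne: "p \<noteq> []" "q' \<noteq> []"
    using Cons.prems q x by (auto simp: paths_between_iff split: if_splits)
  have p': "p \<in> paths_between G (hd p) v" "{u, hd p} \<in> edge_set G" "u \<notin> set p"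
    using Cons.prems x ne by (auto simp: paths_between_iff is_walk_Cons)
  have q': "q' \<in> paths_between G (hd q') v" "{u, hd q'} \<in> edge_set G" "u \<notin> set q'"
      "u \<in> vertex_set G"
    using Cons.prems q ne by (auto simp: paths_between_iff is_walk_Cons)
  show ?case
  proof (cases "hd p = hd q'")
    case True
    then obtain c where "is_cycle G c" "length c + 2 \<le> length p + length q'"
      using Cons.IH[of "hd p" q'] p' q' Cons.prems q x by auto
    then show ?thesis using q by auto
  next
    case False
    have "v \<in> set p" "v \<in> set q'" using p' q' ne last_in_set[of p] last_in_set[of q']
      by (auto simp: paths_between_iff)
    then obtain p1 y p2 where p: "p = p1 @ y # p2" and y: "y \<in> set q'"
      and disj: "\<forall>z\<in>set p1. z \<notin> set q'"
      using split_list_first_prop[of p "\<lambda>z. z \<in> set q'"] by blast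
    obtain q1 q2 where q'_split: "q' = q1 @ y # q2" using y by (meson split_list)
    let ?c = "(u # p1 @ [y]) @ rev q1"
    have walk_p: "is_walk G (u # p1 @ [y])"
      using paths_between_prefix[of "u # p1" y p2 G u v] Cons.prems x p
      by (auto simp: paths_between_iff)
    have walk_q: "is_walk G (q1 @ [y])"
      using paths_between_prefix[of q1 y q2] q' q'_split by (auto simp: paths_between_iff)
    have dist: "distinct ?c"
      using p' q' p q'_split disj by (auto simp: paths_between_iff)
    have cyc: "is_walk G ?c \<and> {last ?c, hd ?c} \<in> edge_set G"
    proof (cases "q1 = []")
      case True
      then show ?thesis using walk_p q' q'_split by (auto simp: insert_commute)
    next
      case nonempty: False
      have "is_walk G q1" "{last q1, y} \<in> edge_set G"
        using walk_q is_walk_append[of q1 "[y]" G] nonempty by auto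
      then have "is_walk G ?c"
        using is_walk_append[of "u # p1 @ [y]" "rev q1" G] nonempty walk_p
        by (simp add: hd_rev insert_commute)
      then show ?thesis using nonempty q' q'_split by (auto simp: last_rev insert_commute)
    qed
    \<comment> \<open>Were both empty, the two paths would share the vertex after
      \<open>u\<close>.\<close>
    have "p1 \<noteq> [] \<or> q1 \<noteq> []" using False p q'_split by auto
    then have "3 \<le> length ?c" by (cases p1; cases q1) auto
    then have "is_cycle G ?c" using cyc dist by (simp add: is_cycle_def)
    moreover have "length ?c + 2 \<le> length (x # p) + length q" using p q q'_split by simp
    ultimately show ?thesis by blast
  qed
qed

section \<open>Contractions of graphs of large girth\<close>

text \<open>The length of a list counts vertices: a path with at most \<open>k\<close> of them has at most \<open>k - 1\<close> edges.\<close>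

locale short_contraction =
  fixes G :: "'a ugraph" and C :: "'a set set" and k :: nat
  assumes simple: "simple_graph G"
    and contracted: "C \<subseteq> edge_set G"
    and k_pos: "k \<ge> 1"
    and cycle_length: "is_cycle G p \<Longrightarrow> 2 * k + 1 \<le> length p"
    and connected_close: "walks_between \<lparr>vertex_set = vertex_set G, edge_set = C\<rparr> u v \<noteq> {} \<Longrightarrow>
      \<exists>p\<in>walks_between G u v. length p \<le> k"
begin

section \<open>Short paths and the components of \<open>C\<close>\<close>

abbreviation H where "H \<equiv> \<lparr>vertex_set = vertex_set G, edge_set = C\<rparr>"

text \<open>Distinct paths within the bound \<open>2 * k + 2\<close> would yield a cycle on at most
  \<open>2 * k\<close> vertices.\<close>

lemma short_paths_unique:
  assumes "p \<in> paths_between G u v" "q \<in> paths_between G u v" "length p + length q \<le> 2 * k + 2"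
  shows "p = q"
proof (rule ccontr)
  assume "p \<noteq> q"
  then obtain c where "is_cycle G c" "length c + 2 \<le> length p + length q"
    using two_paths_contain_cycle[OF assms(1,2)] by blast
  then show False using cycle_length[of c] assms(3) by linarith
qed

lemma path_in_G: "p \<in> paths_between H u v \<Longrightarrow> p \<in> paths_between G u v"
  using paths_between_mono[of p H u v G] contracted by auto

lemma H_path_length:
  assumes "p \<in> paths_between H u v"
  shows "length p \<le> k"
  using assms
proof (induction p arbitrary: v rule: rev_induct)
  case Nil
  then show ?case by simp
next
  case (snoc x p)
  show ?case
  proof (cases "p = []")
    case True
    then show ?thesis using k_pos by simp
  next
    case False
    then have "p \<in> paths_between H u (last p)"
      using snoc.prems is_walk_append[of p "[x]" H] by (auto simp: paths_between_iff)
    then have len: "length p \<le> k" by (rule snoc.IH)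
    have "walks_between H u v \<noteq> {}" using snoc.prems by (auto simp: paths_between_def)
    then obtain r where "r \<in> walks_between G u v" "length r \<le> k"
      using connected_close by blast
    then obtain q where q: "q \<in> paths_between G u v" "length q \<le> k"
      by (meson walk_contains_path order_trans)
    \<comment> \<open>\<open>p @ [x]\<close> has at most \<open>k + 1\<close> vertices by induction
      and \<open>q\<close> at most \<open>k\<close>, so the two coincide and the bound on
      \<open>q\<close> passes to \<open>p @ [x]\<close>.\<close>
    have "p @ [x] = q"
      using short_paths_unique[OF path_in_G[OF snoc.prems] q(1)] len q(2) by simp
    then show ?thesis using q(2) by simp
  qed
qed

text \<open>This is the form in which the absence of cycles in \<open>C\<close> is used.\<close>

lemma H_paths_unique:
  assumes "p \<in> paths_between H u v" "q \<in> paths_between H u v"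
  shows "p = q"
  using short_paths_unique[OF path_in_G[OF assms(1)] path_in_G[OF assms(2)]]
    H_path_length[OF assms(1)] H_path_length[OF assms(2)] by simp

lemma edgeD:
  assumes "{u, v} \<in> edge_set G"
  shows "u \<in> vertex_set G" "v \<in> vertex_set G" "u \<noteq> v"
proof -
  have "{u, v} \<subseteq> vertex_set G" "card {u, v} = 2"
    using assms simple by (auto simp only: simple_graph_def)
  then show "u \<in> vertex_set G" "v \<in> vertex_set G" "u \<noteq> v" by auto
qed

lemma edgeE:
  assumes "e \<in> edge_set G"
  obtains u v where "e = {u, v}" "{u, v} \<in> edge_set G"
proof -
  have "card e = 2" using assms simple by (auto simp only: simple_graph_def)
  then obtain u v where "e = {u, v}" by (auto simp: card_2_iff)
  then show ?thesis using assms that by blast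
qed

text \<open>The edge is itself a path on two vertices, so it coincides with the
  \<open>C\<close>-path between its ends.\<close>

lemma edge_in_component:
  assumes "{u, v} \<in> edge_set G" "walks_between H u v \<noteq> {}"
  shows "{u, v} \<in> C"
proof -
  obtain p where p: "p \<in> paths_between H u v"
    using ex_path[OF assms(2)] by blast
  have edge: "[u, v] \<in> paths_between G u v"
    using assms(1) edgeD[OF assms(1)] by (auto simp: paths_between_iff is_walk_Cons)
  then have "[u, v] = p"
    using short_paths_unique[OF edge path_in_G[OF p]] H_path_length[OF p] k_pos by simp
  then have "[u, v] \<in> paths_between H u v" using p by simp
  then show ?thesis by (simp add: paths_between_iff is_walk_Cons)
qed

text \<open>There are two routes from \<open>a1\<close> to \<open>b2\<close>: the first edge
  followed by a \<open>C\<close>-path, or a \<open>C\<close>-path followed by the second edge. Each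
  has at most \<open>k + 1\<close> vertices, which just meets the limit for uniqueness.\<close>

lemma unique_edge_between_components:
  assumes e1: "{a1, b1} \<in> edge_set G" and e2: "{a2, b2} \<in> edge_set G"
    and a: "walks_between H a1 a2 \<noteq> {}" and b: "walks_between H b1 b2 \<noteq> {}"
    and ab: "walks_between H a1 b1 = {}"
  shows "a1 = a2 \<and> b1 = b2"
proof -
  obtain p where p: "p \<in> paths_between H a1 a2" using ex_path[OF a] by blast
  obtain q where q: "q \<in> paths_between H b1 b2" using ex_path[OF b] by blast
  have disj: "x \<notin> set q" if x: "x \<in> set p" for x
  proof
    assume "x \<in> set q"
    then obtain s where "s \<in> walks_between H b1 x" using paths_between_vertex[OF q] by blast
    moreover obtain r where "r \<in> walks_between H a1 x" using paths_between_vertex[OF p x] by blast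
    ultimately have "r @ tl (rev s) \<in> walks_between H a1 b1"
      by (intro walks_between_append walks_between_rev)
    then show False using ab by blast
  qed
  have p_ne: "p \<noteq> []" "hd p = a1" "last p = a2" and q_ne: "q \<noteq> []" "hd q = b1" "last q = b2"
    using p q by (auto simp: paths_between_iff is_walk_def)
  have "a1 \<notin> set q" "b2 \<notin> set p"
    using disj hd_in_set[OF p_ne(1)] last_in_set[OF q_ne(1)] p_ne(2) q_ne(3) by auto
  then have "a1 # q \<in> paths_between G a1 b2"
    using paths_between_Cons[OF path_in_G[OF q] _ e1] edgeD(1)[OF e1] by blast
  moreover have "p @ [b2] \<in> paths_between G a1 b2"
    using path_in_G[OF p] e2 edgeD(2)[OF e2] \<open>b2 \<notin> set p\<close> p_ne
    by (auto simp: paths_between_iff is_walk_append is_walk_Cons)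
  ultimately have eq: "a1 # q = p @ [b2]"
    using short_paths_unique[of "a1 # q" a1 b2 "p @ [b2]"]
      H_path_length[OF p] H_path_length[OF q] by simp
  then obtain p' where p': "p = a1 # p'" using p_ne by (cases p) auto
  \<comment> \<open>The equation reduces to \<open>q = p' @ [b2]\<close>, so a vertex of
    \<open>p'\<close> would lie on both \<open>p\<close> and \<open>q\<close>.\<close>
  have "p' = []" using eq p' q_ne disj by (cases p') auto
  then show ?thesis using eq p' p_ne q_ne by auto
qed

text \<open>Every edge of the forest joins one of its ends to the next vertex on the path from that end
  to a root chosen in its component.\<close>

lemma card_contracted_le: "card C \<le> card (vertex_set G)"
proof -
  \<comment> \<open>The choice depends only on the set \<open>component_of H v\<close>, so all
    vertices of a component share one root.\<close>
  define root where "root v = (SOME w. w \<in> component_of H v)" for v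
  have path_ex: "\<exists>p. p \<in> paths_between H v (root v)" if "v \<in> vertex_set G" for v
  proof -
    have "v \<in> component_of H v" using walks_between_refl[of v H] that by (auto simp: component_of_def)
    then have "root v \<in> component_of H v" unfolding root_def by (rule someI)
    then show ?thesis by (simp add: component_of_def ex_path)
  qed
  then obtain P where P: "\<And>v. v \<in> vertex_set G \<Longrightarrow> P v \<in> paths_between H v (root v)" by metis
  \<comment> \<open>Index \<open>1\<close> is the second vertex of the path. At a root the path has
    a single vertex and the value is unspecified, which is harmless: the image only has to cover
    \<open>C\<close>.\<close>
  have "C \<subseteq> (\<lambda>v. {v, P v ! 1}) ` vertex_set G"
  proof
    fix e assume e: "e \<in> C"
    then obtain u v where uv: "e = {u, v}" "{u, v} \<in> edge_set G" using contracted edgeE by blast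
    then have V: "u \<in> vertex_set G" "v \<in> vertex_set G" "u \<noteq> v" using edgeD[OF uv(2)] by auto
    have edge: "[u, v] \<in> paths_between H u v"
      using V uv e by (auto simp: paths_between_iff is_walk_Cons)
    then have "component_of H u = component_of H v"
      using V by (subst component_of_eq_iff) (auto simp: paths_between_def)
    then have root_eq: "root v = root u" by (simp add: root_def)
    \<comment> \<open>Either the path from \<open>u\<close> visits \<open>v\<close>, by uniqueness
      as its second vertex, or prepending \<open>v\<close> to it gives the path from
      \<open>v\<close>, whose second vertex is \<open>u\<close>.\<close>
    show "e \<in> (\<lambda>v. {v, P v ! 1}) ` vertex_set G"
    proof (cases "v \<in> set (P u)")
      case True
      then obtain a b where ab: "P u = a @ v # b" by (meson split_list)
      then have "a @ [v] \<in> paths_between H u v" using paths_between_prefix P[OF V(1)] by metis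
      then have "a @ [v] = [u, v]" using H_paths_unique edge by blast
      then have "P u ! 1 = v" using ab by simp
      then show ?thesis using uv V by (intro image_eqI[of _ _ u]) auto
    next
      case False
      have "v # P u \<in> paths_between H v (root v)"
        using paths_between_Cons[OF P[OF V(1)]] False V uv e root_eq by (auto simp: insert_commute)
      then have "P v = v # P u" using H_paths_unique P[OF V(2)] by blast
      moreover have "P u ! 0 = u" using P[OF V(1)]
        by (cases "P u") (auto simp: paths_between_iff is_walk_def)
      ultimately show ?thesis using uv V by (intro image_eqI[of _ _ v]) auto
    qed
  qed
  then show ?thesis using simple by (meson simple_graph_def surj_card_le)
qed

section \<open>Counting the edges of \<open>G/C\<close>\<close>

lemma finite_edges: "finite (edge_set G)"
  using simple by (auto simp: simple_graph_def intro: finite_subset[of _ "Pow (vertex_set G)"])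

text \<open>Edges outside \<open>C\<close> join different components, and no two of them join the
  same pair, so they survive as distinct edges of \<open>G/C\<close>. Only the edges of
  \<open>C\<close> are lost.\<close>

lemma card_contract_edges_ge:
  "card (edge_set G) \<le> card (edge_set (contract_edges G C)) + card (vertex_set G)"
proof -
  let ?f = "\<lambda>e. component_of H ` e"
  have E: "edge_set (contract_edges G C) =
      {{component_of H u, component_of H v} | u v.
        {u, v} \<in> edge_set G \<and> component_of H u \<noteq> component_of H v}"
    by (simp add: contract_edges_def Let_def)
  have sub: "edge_set (contract_edges G C) \<subseteq> ?f ` edge_set G"
  proof
    fix x assume "x \<in> edge_set (contract_edges G C)"
    then obtain u v where "x = ?f {u, v}" "{u, v} \<in> edge_set G" unfolding E by auto
    then show "x \<in> ?f ` edge_set G" by blast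
  qed
  have outside: "walks_between H u v = {}" if "{u, v} \<in> edge_set G - C" for u v
    using that edge_in_component by blast
  have eq_iff: "component_of H u = component_of H v \<longleftrightarrow> walks_between H u v \<noteq> {}"
    if "u \<in> vertex_set G" "v \<in> vertex_set G" for u v
    using component_of_eq_iff[of u H v] that by simp
  have img: "?f ` (edge_set G - C) \<subseteq> edge_set (contract_edges G C)"
  proof (rule image_subsetI)
    fix e assume "e \<in> edge_set G - C"
    then obtain u v where uv: "e = {u, v}" "{u, v} \<in> edge_set G - C" using edgeE by blast
    then have "component_of H u \<noteq> component_of H v"
      using outside[OF uv(2)] eq_iff edgeD[of u v] by blast
    then show "?f e \<in> edge_set (contract_edges G C)" using uv unfolding E by auto
  qed
  have inj: "inj_on ?f (edge_set G - C)"
  proof (rule inj_onI)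
    fix e1 e2 assume e: "e1 \<in> edge_set G - C" "e2 \<in> edge_set G - C" and eq: "?f e1 = ?f e2"
    obtain a1 b1 where 1: "e1 = {a1, b1}" "{a1, b1} \<in> edge_set G" using e edgeE by blast
    obtain a2 b2 where 2: "e2 = {a2, b2}" "{a2, b2} \<in> edge_set G" using e edgeE by blast
    note V = edgeD[OF 1(2)] edgeD[OF 2(2)]
    have none: "walks_between H a1 b1 = {}" using outside e 1 by blast
    \<comment> \<open>Edges are unordered, so their ends can match in two ways; the second reduces
      to the first by swapping the ends of \<open>e2\<close>.\<close>
    have "component_of H a1 = component_of H a2 \<and> component_of H b1 = component_of H b2 \<or>
        component_of H a1 = component_of H b2 \<and> component_of H b1 = component_of H a2"
      using eq 1 2 by (simp add: doubleton_eq_iff)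
    then show "e1 = e2"
    proof
      assume "component_of H a1 = component_of H a2 \<and> component_of H b1 = component_of H b2"
      then show ?thesis using unique_edge_between_components[of a1 b1 a2 b2] 1 2 V none eq_iff
        by simp
    next
      assume "component_of H a1 = component_of H b2 \<and> component_of H b1 = component_of H a2"
      then show ?thesis using unique_edge_between_components[of a1 b1 b2 a2] 1 2 V none eq_iff
        by (simp add: insert_commute)
    qed
  qed
  \<comment> \<open>An infinite set has \<open>card\<close> equal to \<open>0\<close>, so the
    injection bounds cardinalities only once its target is known to be finite.\<close>
  have "finite (edge_set (contract_edges G C))"
    using sub finite_edges by (meson finite_imageI finite_subset)
  then have "card (edge_set G - C) \<le> card (edge_set (contract_edges G C))"
    using card_inj_on_le[OF inj img] by blast
  moreover have "card (edge_set G - C) = card (edge_set G) - card C"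
    using card_Diff_subset contracted finite_edges finite_subset by metis
  ultimately show ?thesis using card_contracted_le by linarith
qed

end

section \<open>Distances\<close>

text \<open>Used with \<open>c = 0\<close> for contracted lengths on \<open>C\<close>-walks and with
  \<open>c = 1\<close> for unit lengths.\<close>

lemma walk_length_const:
  assumes "is_walk G p" "\<And>e. e \<in> edge_set G \<Longrightarrow> l e = c"
  shows "walk_length l p = c * (real (length p) - 1)"
  using assms(1)
proof (induction p)
  case Nil
  then show ?case by (simp add: is_walk_def)
next
  case (Cons x p)
  then show ?case
    by (cases p) (auto simp: walk_length_def is_walk_Cons assms(2) algebra_simps)
qed

text \<open>A \<open>C\<close>-walk has contracted length \<open>0\<close>, so the distance
  \<open>d\<close> in \<open>G\<close> satisfies \<open>d / (k - 1) - 1 \<le> 0\<close>, that is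
  \<open>d \<le> k - 1\<close>.\<close>

lemma contraction_connected_close:
  assumes C: "is_contraction (real k - 1) 1 G (\<lambda>e. 1) C" and k: "k \<ge> 2"
    and conn: "walks_between \<lparr>vertex_set = vertex_set G, edge_set = C\<rparr> u v \<noteq> {}"
  shows "\<exists>p\<in>walks_between G u v. length p \<le> k"
proof -
  let ?H = "\<lparr>vertex_set = vertex_set G, edge_set = C\<rparr>"
  obtain p where p: "p \<in> walks_between ?H u v" using conn by blast
  then have walk: "is_walk ?H p" "hd p = u" "last p = v" by (auto simp: walks_between_def)
  have "C \<subseteq> edge_set G" using C by (simp add: is_contraction_def)
  then have "p \<in> walks_between G u v"
    using walk is_walk_mono[of ?H p G] by (auto simp: walks_between_def)
  moreover have "walk_length (contracted_length C) p = 0"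
    using walk_length_const[OF walk(1), of "contracted_length C" 0] by (simp add: contracted_length_def)
  ultimately have "graph_dist G (contracted_length C) u v \<le> 0"
    unfolding graph_dist_def by (metis INF_lower zero_ereal_def)
  moreover have "u \<in> vertex_set G" "v \<in> vertex_set G"
    using walk by (auto simp: is_walk_def)
  ultimately have le: "graph_dist G (\<lambda>e. 1) u v / ereal (real k - 1) - ereal 1 \<le> 0"
    using C unfolding is_contraction_def by (meson order_trans)
  \<comment> \<open>A strict bound on the infimum supplies a walk below it; fewer than
    \<open>k\<close> edges then means at most \<open>k\<close> vertices.\<close>
  have "graph_dist G (\<lambda>e. 1) u v < ereal (real k)"
    using le k by (cases "graph_dist G (\<lambda>e. 1) u v") (auto simp: field_simps)
  then obtain q where q: "q \<in> walks_between G u v" "walk_length (\<lambda>e. 1) q < real k"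
    unfolding graph_dist_def by (auto simp: INF_less_iff)
  have "walk_length (\<lambda>e. 1) q = real (length q) - 1"
    using walk_length_const[of G q "\<lambda>e. 1" 1] q by (auto simp: walks_between_def)
  then show ?thesis using q by (intro bexI[of _ q]) auto
qed

lemma girth_le_cycle_length:
  assumes "graph_girth G = enat g" "is_cycle G p"
  shows "g \<le> length p"
proof -
  have "graph_girth G \<le> enat (length p)"
    unfolding graph_girth_def using assms(2) by (intro INF_lower) simp
  then show ?thesis using assms(1) by simp
qed

text \<open>From the threshold \<open>(2 / c) ^ k\<close> on, the factor
  \<open>n powr (1 / k)\<close> is at least \<open>2 / c\<close>.\<close>

lemma linear_le_superlinear:
  fixes c :: real
  assumes c: "c > 0" and k: "k \<ge> 1" and n: "real n \<ge> (2 / c) ^ k"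
  shows "real n \<le> c / 2 * real n powr (1 + 1 / real k)"
proof -
  have pos: "real n > 0" using n c by (smt (verit) zero_less_divide_iff zero_less_power)
  have "2 / c = ((2 / c) ^ k) powr (1 / real k)"
    using c k by (simp add: powr_realpow[symmetric] powr_powr)
  also have "\<dots> \<le> real n powr (1 / real k)" using n c by (intro powr_mono2) auto
  finally have "1 \<le> c / 2 * real n powr (1 / real k)" using c by (simp add: field_simps)
  then have "real n * 1 \<le> real n * (c / 2 * real n powr (1 / real k))"
    using pos by (intro mult_left_mono) auto
  then show ?thesis using pos by (simp add: powr_add mult_ac)
qed

theorem theorem29:
  assumes "erdos_girth_conjecture"
  shows "\<forall>k::nat. k \<ge> 2 \<longrightarrow>
    (\<exists>c::real. c > 0 \<and>
      (\<forall>N::nat. \<exists>G::nat ugraph. simple_graph G \<and> card (vertex_set G) \<ge> N \<and>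
        (\<forall>C. is_contraction (real k - 1) 1 G (\<lambda>e. 1) C \<longrightarrow>
           real (card (edge_set (contract_edges G C)))
             \<ge> c * real (card (vertex_set G)) powr (1 + 1 / real k))))"
proof (intro allI impI)
  fix k :: nat assume k: "k \<ge> 2"
  then obtain c :: real where c: "c > 0" and fam: "\<And>N. \<exists>G::nat ugraph. simple_graph G \<and>
      card (vertex_set G) \<ge> N \<and>
      real (card (edge_set G)) \<ge> c * real (card (vertex_set G)) powr (1 + 1 / real k) \<and>
      graph_girth G = enat (2 * k + 1)"
    using assms unfolding erdos_girth_conjecture_def by (metis one_le_numeral order_trans)
  show "\<exists>c::real. c > 0 \<and>
      (\<forall>N::nat. \<exists>G::nat ugraph. simple_graph G \<and> card (vertex_set G) \<ge> N \<and>
        (\<forall>C. is_contraction (real k - 1) 1 G (\<lambda>e. 1) C \<longrightarrow>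
           real (card (edge_set (contract_edges G C)))
             \<ge> c * real (card (vertex_set G)) powr (1 + 1 / real k)))"
  \<comment> \<open>Half of the constant \<open>c\<close> pays for the at most \<open>n\<close>
    edges lost by contracting.\<close>
  proof (intro exI[of _ "c / 2"] conjI allI)
    show "c / 2 > 0" using c by simp
    fix N :: nat
    \<comment> \<open>Enlarging \<open>N\<close> to the threshold makes this linear loss
      affordable.\<close>
    obtain G :: "nat ugraph" where G: "simple_graph G"
        "card (vertex_set G) \<ge> max N (nat \<lceil>(2 / c) ^ k\<rceil>)"
        "real (card (edge_set G)) \<ge> c * real (card (vertex_set G)) powr (1 + 1 / real k)"
        "graph_girth G = enat (2 * k + 1)"
      using fam by blast
    let ?n = "card (vertex_set G)"
    have "real ?n \<ge> (2 / c) ^ k" using G(2) by linarith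
    then have lin: "real ?n \<le> c / 2 * real ?n powr (1 + 1 / real k)"
      using linear_le_superlinear c k by simp
    have "real (card (edge_set (contract_edges G C))) \<ge> c / 2 * real ?n powr (1 + 1 / real k)"
      if C: "is_contraction (real k - 1) 1 G (\<lambda>e. 1) C" for C
    proof -
      interpret short_contraction G C k
        using G(1) C k girth_le_cycle_length[OF G(4)] contraction_connected_close[OF C k]
        by unfold_locales (auto simp: is_contraction_def)
      show ?thesis using card_contract_edges_ge G(3) lin by linarith
    qed
    then show "\<exists>G::nat ugraph. simple_graph G \<and> card (vertex_set G) \<ge> N \<and>
        (\<forall>C. is_contraction (real k - 1) 1 G (\<lambda>e. 1) C \<longrightarrow>
           real (card (edge_set (contract_edges G C)))
             \<ge> c / 2 * real (card (vertex_set G)) powr (1 + 1 / real k))"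
      using G by auto
  qed
qed

end
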